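(* \[ \log 2=\sum_{k=0}^\infty\frac{1}{\alpha^{3k}}\left(\frac{-\beta}{3k+1}+\frac{\beta^2}{3k+2}+\frac{2\beta^3}{3k+3}\right). \]
   Context: $\alpha=(1+\sqrt5)/2$ is the golden ratio and $\beta=-1/\alpha=(1-\sqrt5)/2$; $\log$ is the natural logarithm. *)

theory Defs
  imports Complex_Main
begin

definition golden_alpha :: real where
  "golden_alpha = (1 + sqrt 5) / 2"

definition golden_beta :: real where
  "golden_beta = (1 - sqrt 5) / 2"

lemma golden_beta_eq: "golden_beta = - 1 / golden_alpha"
proof -
  have "golden_alpha > 0"
    unfolding golden_alpha_def by (simp add: add_pos_pos)
  moreover have "golden_beta * golden_alpha = - 1"
    unfolding golden_alpha_def golden_beta_def by (simp add: algebra_simps)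
  ultimately show ?thesis
    by (metis less_irrefl nonzero_eq_divide_eq)
qed

end

theory Submission
  imports Defs "HOL-Analysis.Complex_Transcendental"
begin

text \<open>
  With x = - \<beta> = 1 / \<alpha>, the coefficients 1, 1, -2 are those of the series of
  - ln (1 - x), grouped in threes, minus three times every third of its terms, that is, minus
  the series of - ln (1 - x^3). Hence the sum is ln (1 + x + x^2), and x^2 = 1 - x.
\<close>

lemma sums_minus_ln_one_minus:
  fixes x :: real
  assumes "\<bar>x\<bar> < 1"
  shows "(\<lambda>n. x ^ Suc n / real (Suc n)) sums - ln (1 - x)"
proof -
  have "(\<lambda>n. - (x ^ n) / real n) sums ln (1 - x)"
    using ln_series'[of "- x"] assms by simp
  then have "(\<lambda>n. x ^ n / real n) sums - ln (1 - x)"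
    using sums_minus by fastforce
  \<comment> \<open>The term at index 0 is \<open>x ^ 0 / real 0 = 0\<close>, since division by zero
    yields 0, so the index shift leaves the sum unchanged.\<close>
  then show ?thesis
    using sums_Suc_iff[of "\<lambda>n. x ^ n / real n"] by simp
qed

lemma sums_ln_one_plus_x_plus_square:
  fixes x :: real
  assumes "\<bar>x\<bar> < 1"
  shows "(\<lambda>k. x ^ (3 * k) *
           (x / real (3 * k + 1) + x ^ 2 / real (3 * k + 2) - 2 * x ^ 3 / real (3 * k + 3)))
         sums ln (1 + x + x ^ 2)"
proof -
  have cube: "\<bar>x ^ 3\<bar> < 1"
    using assms by (simp add: power_abs power_less_one_iff)
  \<comment> \<open>Bracketing consecutive terms of a convergent series preserves its sum.\<close>
  have "(\<lambda>k. \<Sum>n = k * 3..<k * 3 + 3. x ^ Suc n / real (Suc n)) sums - ln (1 - x)"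
    using sums_minus_ln_one_minus[OF assms] by (rule sums_group) simp
  then have "(\<lambda>k. (\<Sum>n = k * 3..<k * 3 + 3. x ^ Suc n / real (Suc n))
      - (x ^ 3) ^ Suc k / real (Suc k)) sums (- ln (1 - x) - - ln (1 - x ^ 3))"
    using sums_minus_ln_one_minus[OF cube] by (rule sums_diff)
  moreover have "(\<Sum>n = k * 3..<k * 3 + 3. x ^ Suc n / real (Suc n))
      - (x ^ 3) ^ Suc k / real (Suc k)
    = x ^ (3 * k) *
      (x / real (3 * k + 1) + x ^ 2 / real (3 * k + 2) - 2 * x ^ 3 / real (3 * k + 3))" for k
  proof -
    have "{k * 3..<k * 3 + 3} = {3 * k, 3 * k + 1, 3 * k + 2}"
      by auto
    then have "(\<Sum>n = k * 3..<k * 3 + 3. x ^ Suc n / real (Suc n))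
        = x ^ (3 * k) * (x / real (3 * k + 1) + x ^ 2 / real (3 * k + 2)
            + x ^ 3 / real (3 * k + 3))"
      by (simp add: power_add power2_eq_square power3_eq_cube algebra_simps)
    \<comment> \<open>Since 1/(k+1) = 3/(3k+3), the subtracted term turns the third coefficient into
      1 - 3 = -2.\<close>
    moreover have "(x ^ 3) ^ Suc k / real (Suc k) = x ^ (3 * k) * (3 * x ^ 3 / real (3 * k + 3))"
      by (simp add: power_mult[symmetric] power_add divide_simps)
    ultimately show ?thesis
      by (simp only: right_diff_distrib[symmetric]) (simp add: algebra_simps)
  qed
  moreover have "- ln (1 - x) - - ln (1 - x ^ 3) = ln (1 + x + x ^ 2)"
  proof -
    have "1 - x ^ 3 = (1 - x) * (1 + x + x ^ 2)"
      by (simp add: algebra_simps power2_eq_square power3_eq_cube)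
    \<comment> \<open>By the factorization these two signs force \<open>1 + x + x ^ 2\<close> to be
      positive, so the logarithm of the product splits.\<close>
    moreover have "0 < 1 - x" "0 < 1 - x ^ 3"
      using assms cube by auto
    ultimately show ?thesis
      by (simp add: ln_mult zero_less_mult_iff)
  qed
  ultimately show ?thesis
    by simp
qed

theorem theorem5p3:
  shows "(\<lambda>k::nat. 1 / golden_alpha ^ (3 * k) *
           (- golden_beta / real (3 * k + 1)
            + golden_beta ^ 2 / real (3 * k + 2)
            + 2 * golden_beta ^ 3 / real (3 * k + 3))) sums ln 2"
proof -
  define x where "x = - golden_beta"
  have beta: "golden_beta = - x"
    by (simp add: x_def)
  have alpha: "1 / golden_alpha ^ n = x ^ n" for n
    by (simp add: x_def golden_beta_eq power_divide)
  have sum_eq_2: "1 + x + x ^ 2 = 2"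
    by (simp add: x_def golden_beta_def power2_eq_square field_simps)
  have "\<bar>x\<bar> < 1"
    \<comment> \<open>From 1 < 5 < 9 follows 1 < sqrt 5 < 3, so x = (sqrt 5 - 1)/2 lies strictly
      between 0 and 1.\<close>
    using real_sqrt_less_mono[of 1 5] real_sqrt_less_mono[of 5 9]
    by (simp add: x_def golden_beta_def abs_less_iff)
  then show ?thesis
    \<comment> \<open>Substituting -x for \<beta> flips the sign of the odd powers only: -\<beta> =
      x and 2\<beta>^3 = -2x^3.\<close>
    using sums_ln_one_plus_x_plus_square[of x] unfolding sum_eq_2 by (simp add: alpha beta)
qed

end
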